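(* Let $q:\mathcal P\to\mathbb{R}$ be a function. Consider the feasibility problem (F): find functions $\psi_t^{\pm}:\mathcal P\to\mathbb{R}$ ($t=-n_b+1,\dots,T-1$), $\zeta_t^\pm:\mathcal P\to\mathbb{R}$ ($t=-n_a+1,\dots,T$) and $\mu_t:\mathcal P\to\mathbb{R}$ ($t=1,\dots,T$) such that for all $(a,b)\in\mathcal P$: (1) $\psi_t^\pm(a,b)\ge0$ and $\zeta_t^\pm(a,b)\ge0$ for all $t$ in the respective ranges; (2) $-Q(a,b)>0$; (3) $\psi^+-\psi^-=\mu\star b$ and $\zeta^+-\zeta^-=\mu\star[1;a]$ at $(a,b)$. Then (F) certifies positivity of $q$: if (F) is feasible, then $q(a,b)>0$ for all $(a,b)\in\mathcal P$ (equivalently, for all $(a,b,\Delta u,\Delta y)\in\bar{\mathcal P}$). Moreover, (F) is a strong alternative of the statement $$\text{(E)}\qquad\exists\,(a,b,\Delta u,\Delta y)\in\bar{\mathcal P}\ \text{ such that }\ -q(a,b)\ge0;$$ that is, exactly one of "(F) is feasible" and (E) holds.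
   Context: Data and consistency sets. Fix integers $n_a>n_b\ge1$, a horizon $T\ge1$, noise bounds $\epsilon_u,\epsilon_y\ge0$, and recorded data $\hat u=(\hat u_t)_{t=-n_b+1}^{T-1}$, $\hat y=(\hat y_t)_{t=-n_a+1}^{T}$ (real numbers). For $a\in\mathbb{R}^{n_a}$, $b\in\mathbb{R}^{n_b}$ put $h_t(a,b)=\hat y_t+\sum_{i=1}^{n_a}a_i\hat y_{t-i}-\sum_{i=1}^{n_b}b_i\hat u_{t-i}$ for $t=1,\dots,T$, and $h=(h_t)_{t=1}^T$. The set $\bar{\mathcal P}$ consists of all $(a,b,\Delta u,\Delta y)$ with $a\in\mathbb{R}^{n_a}$, $b\in\mathbb{R}^{n_b}$, $\Delta u=(\Delta u_t)_{t=-n_b+1}^{T-1}\in\mathbb{R}^{T+n_b-1}$, $\Delta y=(\Delta y_t)_{t=-n_a+1}^{T}\in\mathbb{R}^{T+n_a}$, $\|\Delta u\|_\infty\le\epsilon_u$, $\|\Delta y\|_\infty\le\epsilon_y$, and $$0=h_t(a,b)-\sum_{i=1}^{n_a}a_i\Delta y_{t-i}+\sum_{i=1}^{n_b}b_i\Delta u_{t-i}-\Delta y_t\qquad\text{for all }t=1,\dots,T.$$ The set $\mathcal P\subset\mathbb{R}^{n_a}\times\mathbb{R}^{n_b}$ is the projection of $\bar{\mathcal P}$ onto the coordinates $(a,b)$. Notation. $\psi^\pm=(\psi^\pm_t)_{t=-n_b+1}^{T-1}$, $\zeta^\pm=(\zeta_t^\pm)_{t=-n_a+1}^{T}$, $\mu=(\mu_t)_{t=1}^T$,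 and $$Q(a,b)=-q(a,b)+\epsilon_u\mathbf 1^T(\psi^++\psi^-)+h^T\mu+\epsilon_y\mathbf 1^T(\zeta^++\zeta^-),$$ with all multipliers and $h$ evaluated at $(a,b)$ and $\mathbf 1$ the all-ones vector. The symbol $\star$ is cross-correlation; with the convention $\mu_t=0$ for $t\notin\{1,\dots,T\}$, the equations in (3) read entrywise $$\psi_s^+-\psi_s^-=\sum_{i=1}^{n_b}b_i\,\mu_{s+i}\quad(s=-n_b+1,\dots,T-1),\qquad \zeta_s^+-\zeta_s^-=\mu_s+\sum_{i=1}^{n_a}a_i\,\mu_{s+i}\quad(s=-n_a+1,\dots,T).$$ *)

theory Defs
  imports Complex_Main "HOL-Library.FuncSet"
begin

text \<open>
  A real vector with entries indexed by a set \<open>I\<close> of (possibly negative) integers is a function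
  that is extensional on \<open>I\<close>, so that vectors are equal iff their entries on \<open>I\<close> are.
\<close>

type_synonym vec = "int \<Rightarrow> real"

definition Rvec :: "int set \<Rightarrow> vec set" where
  "Rvec I = (I \<rightarrow>\<^sub>E UNIV)"

definition inf_norm :: "int set \<Rightarrow> vec \<Rightarrow> real" where
  "inf_norm I x = Max ((\<lambda>t. \<bar>x t\<bar>) ` I)"

definition u_idx :: "int \<Rightarrow> int \<Rightarrow> int set" where
  "u_idx nb T = {- nb + 1..T - 1}"

definition y_idx :: "int \<Rightarrow> int \<Rightarrow> int set" where
  "y_idx na T = {- na + 1..T}"

text \<open>
  The recorded data \<open>uh\<close>, \<open>yh\<close> are total functions on the integers; only their entries at
  \<open>u_idx nb T\<close> and \<open>y_idx na T\<close>, respectively, are ever used.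
\<close>

definition residual :: "int \<Rightarrow> int \<Rightarrow> vec \<Rightarrow> vec \<Rightarrow> vec \<Rightarrow> vec \<Rightarrow> int \<Rightarrow> real" where
  "residual na nb uh yh a b t =
     yh t + (\<Sum>i=1..na. a i * yh (t - i)) - (\<Sum>i=1..nb. b i * uh (t - i))"

definition Pbar ::
  "int \<Rightarrow> int \<Rightarrow> int \<Rightarrow> real \<Rightarrow> real \<Rightarrow> vec \<Rightarrow> vec \<Rightarrow> (vec \<times> vec \<times> vec \<times> vec) set" where
  "Pbar na nb T eps_u eps_y uh yh =
     {(a, b, du, dy).
        a \<in> Rvec {1..na} \<and> b \<in> Rvec {1..nb} \<and>
        du \<in> Rvec (u_idx nb T) \<and> dy \<in> Rvec (y_idx na T) \<and>
        inf_norm (u_idx nb T) du \<le> eps_u \<and> inf_norm (y_idx na T) dy \<le> eps_y \<and>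
        (\<forall>t\<in>{1..T}. 0 = residual na nb uh yh a b t - (\<Sum>i=1..na. a i * dy (t - i))
                          + (\<Sum>i=1..nb. b i * du (t - i)) - dy t)}"

definition P ::
  "int \<Rightarrow> int \<Rightarrow> int \<Rightarrow> real \<Rightarrow> real \<Rightarrow> vec \<Rightarrow> vec \<Rightarrow> (vec \<times> vec) set" where
  "P na nb T eps_u eps_y uh yh =
     (\<lambda>(a, b, du, dy). (a, b)) ` Pbar na nb T eps_u eps_y uh yh"

text \<open>
  Cross-correlation of \<open>m\<close>, with entries indexed by \<open>I\<close> and continued by zero outside \<open>I\<close>,
  with \<open>c\<close>, with entries indexed by \<open>J\<close>.
\<close>

definition cross_corr :: "int set \<Rightarrow> vec \<Rightarrow> int set \<Rightarrow> vec \<Rightarrow> int \<Rightarrow> real" where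
  "cross_corr I m J c s = (\<Sum>i\<in>J. c i * (if s + i \<in> I then m (s + i) else 0))"

text \<open>The stacked vector \<open>[1; a]\<close>, with entries indexed by \<open>{0..na}\<close>.\<close>

definition one_cons :: "vec \<Rightarrow> vec" where
  "one_cons a = a(0 := 1)"

text \<open>
  A family of scalar functions on \<open>P\<close>, such as the multipliers \<open>\<psi>\<^sub>t(a,b)\<close>, takes its index first.
  Here \<open>psi_p\<close>, \<open>psi_m\<close>, \<open>zeta_p\<close>, \<open>zeta_m\<close> stand for \<open>\<psi>\<^sup>+\<close>, \<open>\<psi>\<^sup>-\<close>, \<open>\<zeta>\<^sup>+\<close>, \<open>\<zeta>\<^sup>-\<close>.
  Functions on \<open>P\<close> are total functions whose values outside \<open>P\<close> are irrelevant, and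
  likewise for indices outside the respective ranges.
\<close>

type_synonym multiplier = "int \<Rightarrow> vec \<Rightarrow> vec \<Rightarrow> real"

definition Q ::
  "int \<Rightarrow> int \<Rightarrow> int \<Rightarrow> real \<Rightarrow> real \<Rightarrow> vec \<Rightarrow> vec \<Rightarrow> (vec \<Rightarrow> vec \<Rightarrow> real) \<Rightarrow>
   multiplier \<Rightarrow> multiplier \<Rightarrow> multiplier \<Rightarrow> multiplier \<Rightarrow> multiplier \<Rightarrow> vec \<Rightarrow> vec \<Rightarrow> real" where
  "Q na nb T eps_u eps_y uh yh q psi_p psi_m zeta_p zeta_m mu a b =
     - q a b
     + eps_u * (\<Sum>t\<in>u_idx nb T. psi_p t a b + psi_m t a b)
     + (\<Sum>t=1..T. residual na nb uh yh a b t * mu t a b)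
     + eps_y * (\<Sum>t\<in>y_idx na T. zeta_p t a b + zeta_m t a b)"

definition F_solution ::
  "int \<Rightarrow> int \<Rightarrow> int \<Rightarrow> real \<Rightarrow> real \<Rightarrow> vec \<Rightarrow> vec \<Rightarrow> (vec \<Rightarrow> vec \<Rightarrow> real) \<Rightarrow>
   multiplier \<Rightarrow> multiplier \<Rightarrow> multiplier \<Rightarrow> multiplier \<Rightarrow> multiplier \<Rightarrow> bool" where
  "F_solution na nb T eps_u eps_y uh yh q psi_p psi_m zeta_p zeta_m mu \<longleftrightarrow>
     (\<forall>(a, b)\<in>P na nb T eps_u eps_y uh yh.
        (\<forall>t\<in>u_idx nb T. psi_p t a b \<ge> 0 \<and> psi_m t a b \<ge> 0) \<and>
        (\<forall>t\<in>y_idx na T. zeta_p t a b \<ge> 0 \<and> zeta_m t a b \<ge> 0) \<and>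
        - Q na nb T eps_u eps_y uh yh q psi_p psi_m zeta_p zeta_m mu a b > 0 \<and>
        (\<forall>s\<in>u_idx nb T. psi_p s a b - psi_m s a b =
            cross_corr {1..T} (\<lambda>t. mu t a b) {1..nb} b s) \<and>
        (\<forall>s\<in>y_idx na T. zeta_p s a b - zeta_m s a b =
            cross_corr {1..T} (\<lambda>t. mu t a b) {0..na} (one_cons a) s))"

definition F_feasible ::
  "int \<Rightarrow> int \<Rightarrow> int \<Rightarrow> real \<Rightarrow> real \<Rightarrow> vec \<Rightarrow> vec \<Rightarrow> (vec \<Rightarrow> vec \<Rightarrow> real) \<Rightarrow> bool" where
  "F_feasible na nb T eps_u eps_y uh yh q \<longleftrightarrow>
     (\<exists>psi_p psi_m zeta_p zeta_m mu.
        F_solution na nb T eps_u eps_y uh yh q psi_p psi_m zeta_p zeta_m mu)"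

definition E_holds ::
  "int \<Rightarrow> int \<Rightarrow> int \<Rightarrow> real \<Rightarrow> real \<Rightarrow> vec \<Rightarrow> vec \<Rightarrow> (vec \<Rightarrow> vec \<Rightarrow> real) \<Rightarrow> bool" where
  "E_holds na nb T eps_u eps_y uh yh q \<longleftrightarrow>
     (\<exists>(a, b, du, dy)\<in>Pbar na nb T eps_u eps_y uh yh. - q a b \<ge> 0)"

end

theory Submission
  imports Defs
begin

text \<open>
  The proof is weak Lagrangian duality, carried out pointwise in \<open>(a, b)\<close>. For fixed \<open>(a, b)\<close> the
  constraints on the noise \<open>(du, dy)\<close> are linear equations and box constraints; \<open>\<mu>\<close> is the multiplier
  of the equations and \<open>\<psi>\<^sup>\<plusminus>\<close>, \<open>\<zeta>\<^sup>\<plusminus>\<close> are those of the box constraints. If \<open>(a, b) \<in> \<P>\<close>, choose noise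
  that is consistent with the data. Pairing the equations with \<open>\<mu>\<close> expresses \<open>h\<^sup>T\<mu>\<close> as a linear
  functional of the noise (\<open>sum_mult_convolution\<close>), whose coefficients are
  \<open>\<mu> \<star> [1; a] = \<zeta>\<^sup>+ - \<zeta>\<^sup>-\<close> and \<open>-(\<mu> \<star> b) = -(\<psi>\<^sup>+ - \<psi>\<^sup>-)\<close>. The box bounds then show that this functional
  is at least minus the \<open>\<epsilon>\<close>-weighted sums of the multipliers (\<open>abs_sum_mult_diff_le\<close>). So
  \<open>Q(a, b) \<ge> -q(a, b)\<close>, and \<open>-Q(a, b) > 0\<close> forces \<open>q(a, b) > 0\<close>. This is the certificate, and it
  excludes (E).

  If (E) fails then \<open>q > 0\<close> on \<open>\<P>\<close>, and the zero multipliers solve (F), because \<open>Q\<close> reduces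
  to \<open>-q\<close>. Nothing is lost by this choice: the value \<open>q(a, b)\<close> does not depend on the noise, and
  a point of \<open>\<P>\<close> has consistent noise by definition, so the largest dual value there, which is
  \<open>q(a, b)\<close> by weak duality, is attained at zero.
\<close>

text \<open>
  Cross-correlation is the adjoint of convolution. The set \<open>S\<close> has to contain every shift \<open>t - i\<close>
  that occurs; the pairs \<open>(s, i)\<close> that do not arise from such a shift, those with \<open>s + i \<notin> I\<close>,
  contribute nothing on account of the continuation by zero.
\<close>

lemma sum_mult_convolution:
  assumes "finite I" and "finite S"
    and shift: "\<And>t i. t \<in> I \<Longrightarrow> i \<in> J \<Longrightarrow> t - i \<in> S"
  shows "(\<Sum>t\<in>I. m t * (\<Sum>i\<in>J. c i * d (t - i))) = (\<Sum>s\<in>S. d s * cross_corr I m J c s)"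
proof -
  have reindex: "(\<Sum>s\<in>S. d s * (if s + i \<in> I then m (s + i) else 0)) = (\<Sum>t\<in>I. m t * d (t - i))"
    if "i \<in> J" for i
  proof -
    have "(\<Sum>s\<in>S. d s * (if s + i \<in> I then m (s + i) else 0))
        = (\<Sum>s\<in>{s \<in> S. s + i \<in> I}. d s * m (s + i))"
      using \<open>finite S\<close> by (intro sum.mono_neutral_cong_right) auto
    also have "\<dots> = (\<Sum>t\<in>I. m t * d (t - i))"
      using shift that
      by (intro sum.reindex_bij_witness[where i = "\<lambda>t. t - i" and j = "\<lambda>s. s + i"]) auto
    finally show ?thesis .
  qed
  have "(\<Sum>s\<in>S. d s * cross_corr I m J c s)
      = (\<Sum>s\<in>S. \<Sum>i\<in>J. c i * (d s * (if s + i \<in> I then m (s + i) else 0)))"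
    by (simp add: cross_corr_def sum_distrib_left mult.left_commute)
  also have "\<dots> = (\<Sum>i\<in>J. c i * (\<Sum>s\<in>S. d s * (if s + i \<in> I then m (s + i) else 0)))"
    by (subst sum.swap) (simp only: sum_distrib_left)
  also have "\<dots> = (\<Sum>i\<in>J. \<Sum>t\<in>I. m t * (c i * d (t - i)))"
    by (simp add: reindex sum_distrib_left mult.left_commute)
  also have "\<dots> = (\<Sum>t\<in>I. m t * (\<Sum>i\<in>J. c i * d (t - i)))"
    by (subst sum.swap) (simp only: sum_distrib_left)
  finally show ?thesis ..
qed

text \<open>
  This is Hoelder's inequality between the maximum norm of \<open>d\<close> and the \<open>1\<close>-norm of \<open>p - m\<close>, where
  nonnegativity bounds \<open>\<bar>p - m\<bar>\<close> by \<open>p + m\<close>.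
\<close>

lemma abs_sum_mult_diff_le:
  fixes d p m :: vec
  assumes "finite S" and norm: "inf_norm S d \<le> e"
    and nonneg: "\<And>s. s \<in> S \<Longrightarrow> p s \<ge> 0 \<and> m s \<ge> 0"
  shows "\<bar>\<Sum>s\<in>S. d s * (p s - m s)\<bar> \<le> e * (\<Sum>s\<in>S. p s + m s)"
proof -
  have "\<bar>d s * (p s - m s)\<bar> \<le> e * (p s + m s)" if "s \<in> S" for s
  proof -
    have "\<bar>d s\<bar> \<le> inf_norm S d"
      unfolding inf_norm_def using that \<open>finite S\<close> by (intro Max_ge) auto
    moreover have "\<bar>p s - m s\<bar> \<le> p s + m s"
      using nonneg[OF that] by linarith
    ultimately show ?thesis
      unfolding abs_mult using norm by (intro mult_mono) auto
  qed
  then have "(\<Sum>s\<in>S. \<bar>d s * (p s - m s)\<bar>) \<le> (\<Sum>s\<in>S. e * (p s + m s))"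
    by (rule sum_mono)
  then show ?thesis
    using sum_abs[of "\<lambda>s. d s * (p s - m s)" S] unfolding sum_distrib_left by linarith
qed

lemma sum_one_cons:
  fixes na :: int
  assumes "na \<ge> 0"
  shows "(\<Sum>i=0..na. one_cons a i * f i) = f 0 + (\<Sum>i=1..na. a i * f i)"
proof -
  have "{0..na} = insert 0 {1..na}"
    using assms by auto
  then show ?thesis
    by (simp add: one_cons_def)
qed

lemma residual_pairing_eq:
  assumes "na \<ge> 0" and Pbar: "(a, b, du, dy) \<in> Pbar na nb T eps_u eps_y uh yh"
  shows "(\<Sum>t=1..T. residual na nb uh yh a b t * mu t)
       = (\<Sum>s\<in>y_idx na T. dy s * cross_corr {1..T} mu {0..na} (one_cons a) s)
         - (\<Sum>s\<in>u_idx nb T. du s * cross_corr {1..T} mu {1..nb} b s)"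
proof -
  have "residual na nb uh yh a b t
      = (\<Sum>i=0..na. one_cons a i * dy (t - i)) - (\<Sum>i=1..nb. b i * du (t - i))"
    if "t \<in> {1..T}" for t
  proof -
    have "0 = residual na nb uh yh a b t - (\<Sum>i=1..na. a i * dy (t - i))
              + (\<Sum>i=1..nb. b i * du (t - i)) - dy t"
      using Pbar that unfolding Pbar_def by blast
    then show ?thesis
      using sum_one_cons[OF \<open>na \<ge> 0\<close>, of a "\<lambda>i. dy (t - i)"] by simp
  qed
  then have "(\<Sum>t=1..T. residual na nb uh yh a b t * mu t)
      = (\<Sum>t=1..T. mu t * (\<Sum>i=0..na. one_cons a i * dy (t - i)))
        - (\<Sum>t=1..T. mu t * (\<Sum>i=1..nb. b i * du (t - i)))"
    by (simp add: right_diff_distrib mult.commute[of _ "mu _"] flip: sum_subtractf)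
  moreover have "(\<Sum>t=1..T. mu t * (\<Sum>i=0..na. one_cons a i * dy (t - i)))
      = (\<Sum>s\<in>y_idx na T. dy s * cross_corr {1..T} mu {0..na} (one_cons a) s)"
    by (rule sum_mult_convolution) (auto simp: y_idx_def)
  moreover have "(\<Sum>t=1..T. mu t * (\<Sum>i=1..nb. b i * du (t - i)))
      = (\<Sum>s\<in>u_idx nb T. du s * cross_corr {1..T} mu {1..nb} b s)"
    by (rule sum_mult_convolution) (auto simp: u_idx_def)
  ultimately show ?thesis
    by simp
qed

text \<open>
  Weak duality: consistent noise makes the terms of \<open>Q\<close> other than \<open>-q\<close> add up to a
  nonnegative number.
\<close>

lemma F_solution_imp_pos:
  assumes "na \<ge> 0"
    and sol: "F_solution na nb T eps_u eps_y uh yh q psi_p psi_m zeta_p zeta_m mu"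
    and Pbar: "(a, b, du, dy) \<in> Pbar na nb T eps_u eps_y uh yh"
  shows "q a b > 0"
proof -
  have "(a, b) \<in> P na nb T eps_u eps_y uh yh"
    unfolding P_def using Pbar by force
  then have psi: "\<And>t. t \<in> u_idx nb T \<Longrightarrow> psi_p t a b \<ge> 0 \<and> psi_m t a b \<ge> 0"
    and zeta: "\<And>t. t \<in> y_idx na T \<Longrightarrow> zeta_p t a b \<ge> 0 \<and> zeta_m t a b \<ge> 0"
    and Q_neg: "- Q na nb T eps_u eps_y uh yh q psi_p psi_m zeta_p zeta_m mu a b > 0"
    and psi_diff: "\<And>s. s \<in> u_idx nb T \<Longrightarrow>
        psi_p s a b - psi_m s a b = cross_corr {1..T} (\<lambda>t. mu t a b) {1..nb} b s"
    and zeta_diff: "\<And>s. s \<in> y_idx na T \<Longrightarrow>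
        zeta_p s a b - zeta_m s a b = cross_corr {1..T} (\<lambda>t. mu t a b) {0..na} (one_cons a) s"
    using sol unfolding F_solution_def by blast+
  have norms: "inf_norm (u_idx nb T) du \<le> eps_u" "inf_norm (y_idx na T) dy \<le> eps_y"
    using Pbar unfolding Pbar_def by blast+
  have "(\<Sum>t=1..T. residual na nb uh yh a b t * mu t a b)
      = (\<Sum>s\<in>y_idx na T. dy s * (zeta_p s a b - zeta_m s a b))
        - (\<Sum>s\<in>u_idx nb T. du s * (psi_p s a b - psi_m s a b))"
    unfolding residual_pairing_eq[OF \<open>na \<ge> 0\<close> Pbar] by (simp add: psi_diff zeta_diff)
  moreover have "\<bar>\<Sum>s\<in>y_idx na T. dy s * (zeta_p s a b - zeta_m s a b)\<bar>
      \<le> eps_y * (\<Sum>s\<in>y_idx na T. zeta_p s a b + zeta_m s a b)"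
    using norms zeta by (intro abs_sum_mult_diff_le) (auto simp: y_idx_def)
  moreover have "\<bar>\<Sum>s\<in>u_idx nb T. du s * (psi_p s a b - psi_m s a b)\<bar>
      \<le> eps_u * (\<Sum>s\<in>u_idx nb T. psi_p s a b + psi_m s a b)"
    using norms psi by (intro abs_sum_mult_diff_le) (auto simp: u_idx_def)
  ultimately show ?thesis
    using Q_neg unfolding Q_def by linarith
qed

lemma pos_imp_F_feasible:
  assumes "\<forall>(a, b)\<in>P na nb T eps_u eps_y uh yh. q a b > 0"
  shows "F_feasible na nb T eps_u eps_y uh yh q"
proof -
  let ?z = "\<lambda>_ _ _. 0 :: real"
  have "F_solution na nb T eps_u eps_y uh yh q ?z ?z ?z ?z ?z"
    using assms by (auto simp: F_solution_def Q_def cross_corr_def)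
  then show ?thesis
    unfolding F_feasible_def by blast
qed

theorem theorem4p1:
  fixes na nb T :: int
    and eps_u eps_y :: real
    and uh yh :: vec
    and q :: "vec \<Rightarrow> vec \<Rightarrow> real"
  assumes "na > nb" and "nb \<ge> 1" and "T \<ge> 1"
    and "eps_u \<ge> 0" and "eps_y \<ge> 0"
  shows "(F_feasible na nb T eps_u eps_y uh yh q \<longrightarrow>
            (\<forall>(a, b)\<in>P na nb T eps_u eps_y uh yh. q a b > 0)) \<and>
         ((\<forall>(a, b)\<in>P na nb T eps_u eps_y uh yh. q a b > 0) \<longleftrightarrow>
            (\<forall>(a, b, du, dy)\<in>Pbar na nb T eps_u eps_y uh yh. q a b > 0)) \<and>
         ((F_feasible na nb T eps_u eps_y uh yh q \<and> \<not> E_holds na nb T eps_u eps_y uh yh q) \<or>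
          (\<not> F_feasible na nb T eps_u eps_y uh yh q \<and> E_holds na nb T eps_u eps_y uh yh q))"
proof -
  let ?pos = "\<forall>(a, b)\<in>P na nb T eps_u eps_y uh yh. q a b > 0"
  have fibres: "?pos \<longleftrightarrow> (\<forall>(a, b, du, dy)\<in>Pbar na nb T eps_u eps_y uh yh. q a b > 0)"
    unfolding P_def by fastforce
  have "na \<ge> 0"
    using assms by linarith
  then have "F_feasible na nb T eps_u eps_y uh yh q \<longrightarrow> ?pos"
    unfolding fibres F_feasible_def using F_solution_imp_pos by blast
  moreover have "?pos \<longrightarrow> F_feasible na nb T eps_u eps_y uh yh q"
    using pos_imp_F_feasible by blast
  moreover have "E_holds na nb T eps_u eps_y uh yh q \<longleftrightarrow> \<not> ?pos"
    unfolding fibres E_holds_def by (force simp: not_less)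
  ultimately show ?thesis
    using fibres by blast
qed

end
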